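(* Let $\nu_1,\nu_2:\mathbb{R}^N\to\mathbb{R}$ be two convex fairness measures with dual sets $\mathcal{W}_1=\mathrm{dom}(\nu_1^* )\cap\mathbb{R}_{\uparrow}^N$ and $\mathcal{W}_2=\mathrm{dom}(\nu_2^* )\cap\mathbb{R}_{\uparrow}^N$, respectively. Then $\nu_1$ is equivalent to $\nu_2$ if and only if $\mathcal{W}_1=\beta\mathcal{W}_2$ for some $\beta>0$.
   Context: $\mathbb{R}_{\uparrow}^N=\{\mathbf{x}\in\mathbb{R}^N\mid x_1\le\dots\le x_N\}$. For $\nu:\mathbb{R}^N\to\mathbb{R}$, $\nu^*(\mathbf{w})=\sup_{\mathbf{u}\in\mathbb{R}^N}\{\mathbf{u}^\top\mathbf{w}-\nu(\mathbf{u})\}\in(-\infty,\infty]$ is its convex conjugate and $\mathrm{dom}(\nu^* )=\{\mathbf{w}\mid\nu^*(\mathbf{w})<\infty\}$. $\beta\mathcal{W}_2=\{\beta\mathbf{w}\mid\mathbf{w}\in\mathcal{W}_2\}$. Two functions $\nu_1,\nu_2:\mathbb{R}^N\to\mathbb{R}$ are called equivalent if there exists $\beta>0$ such that $\nu_1(\mathbf{u})=\beta\nu_2(\mathbf{u})$ for all $\mathbf{u}\in\mathbb{R}^N$. A function $\phi:\mathbb{R}^N\to\mathbb{R}$ is a convex fairness measure if it satisfies: - Continuity: $\phi$ is continuous on $\mathbb{R}^N$. - Normalization: $\phi(\mathbf{u})\ge0$ for all $\mathbf{u}\in\mathbb{R}^N$, and $\phi(\mathbf{u})=0$ if and only if $\mathbf{u}=\alpha\mathbf{1}$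 for some $\alpha\in\mathbb{R}$ ($\mathbf{1}$ the all-ones vector). - Symmetry: $\phi(P\mathbf{u})=\phi(\mathbf{u})$ for all $\mathbf{u}$ and all permutation matrices $P$. - Translation Invariance: $\phi(\mathbf{u}+\alpha\mathbf{1})=\phi(\mathbf{u})$ for all $\mathbf{u}$ and $\alpha\in\mathbb{R}$. - Positive Homogeneity: $\phi(\alpha\mathbf{u})=\alpha\phi(\mathbf{u})$ for all $\mathbf{u}$ and $\alpha>0$. - Convexity: $\phi(\alpha\mathbf{u}^1+(1-\alpha)\mathbf{u}^2)\le\alpha\phi(\mathbf{u}^1)+(1-\alpha)\phi(\mathbf{u}^2)$ for all $\mathbf{u}^1,\mathbf{u}^2\in\mathbb{R}^N$ and $\alpha\in(0,1)$. *)

theory Defs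
  imports "HOL-Analysis.Analysis"
begin

(* R^N is the type real ^ 'n. Ordered vectors need an ordered index set, so 'n is a finite
   linear order, which is order-isomorphic to {1..N} with N = CARD('n). *)

definition ordered_vecs :: "(real ^ 'n::{finite,linorder}) set" where
  "ordered_vecs = {x. \<forall>i j. i \<le> j \<longrightarrow> x $ i \<le> x $ j}"

definition conjugate :: "(real ^ 'n \<Rightarrow> real) \<Rightarrow> real ^ 'n \<Rightarrow> ereal" where
  "conjugate \<nu> w = (SUP u. ereal (u \<bullet> w - \<nu> u))"

definition effective_domain :: "('a \<Rightarrow> ereal) \<Rightarrow> 'a set" where
  "effective_domain f = {w. f w < \<infinity>}"

definition permutation_matrix :: "real ^ 'n ^ 'n \<Rightarrow> bool" where
  "permutation_matrix P \<longleftrightarrow>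
     (\<exists>p. p permutes UNIV \<and> P = (\<chi> i j. if j = p i then 1 else 0))"

(* The literal 1 :: real ^ 'n is the all-ones vector. *)
definition convex_fairness_measure :: "(real ^ 'n \<Rightarrow> real) \<Rightarrow> bool" where
  "convex_fairness_measure \<phi> \<longleftrightarrow>
     continuous_on UNIV \<phi> \<and>
     (\<forall>u. \<phi> u \<ge> 0) \<and>
     (\<forall>u. \<phi> u = 0 \<longleftrightarrow> (\<exists>\<alpha>. u = \<alpha> *\<^sub>R 1)) \<and>
     (\<forall>u P. permutation_matrix P \<longrightarrow> \<phi> (P *v u) = \<phi> u) \<and>
     (\<forall>u \<alpha>. \<phi> (u + \<alpha> *\<^sub>R 1) = \<phi> u) \<and>
     (\<forall>u \<alpha>. \<alpha> > 0 \<longrightarrow> \<phi> (\<alpha> *\<^sub>R u) = \<alpha> * \<phi> u) \<and>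
     convex_on UNIV \<phi>"

definition equivalent_measures :: "(real ^ 'n \<Rightarrow> real) \<Rightarrow> (real ^ 'n \<Rightarrow> real) \<Rightarrow> bool" where
  "equivalent_measures \<nu>1 \<nu>2 \<longleftrightarrow> (\<exists>\<beta>>0. \<forall>u. \<nu>1 u = \<beta> * \<nu>2 u)"

definition dual_set :: "(real ^ 'n::{finite,linorder} \<Rightarrow> real) \<Rightarrow> (real ^ 'n::{finite,linorder}) set" where
  "dual_set \<nu> = effective_domain (conjugate \<nu>) \<inter> ordered_vecs"

end

theory Submission
  imports Defs
begin

text \<open>
  A positively homogeneous \<open>\<nu>\<close> has a conjugate with values in \<open>{0, \<infinity>}\<close>, so the domain of
  the conjugate is the polar-type set \<open>K = {w. \<forall>u. u \<bullet> w \<le> \<nu> u}\<close>. By symmetry \<open>K\<close> is invariant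
  under permutations of coordinates, so it is determined by its ordered elements. Conversely, \<open>K\<close>
  determines \<open>\<nu>\<close>, which is its support function: separate the epigraph of \<open>\<nu>\<close>, a closed convex
  cone, from a point slightly below the graph.
\<close>

lemma effective_domain_conjugate_homogeneous:
  fixes \<nu> :: "real ^ 'n \<Rightarrow> real"
  assumes hom: "\<And>u \<alpha>. \<alpha> > 0 \<Longrightarrow> \<nu> (\<alpha> *\<^sub>R u) = \<alpha> * \<nu> u"
  shows "effective_domain (conjugate \<nu>) = {w. \<forall>u. u \<bullet> w \<le> \<nu> u}"
proof (intro set_eqI iffI)
  fix w assume "w \<in> effective_domain (conjugate \<nu>)"
  then have fin: "conjugate \<nu> w < \<infinity>"
    by (simp add: effective_domain_def)
  have ge: "ereal (u \<bullet> w - \<nu> u) \<le> conjugate \<nu> w" for u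
    unfolding conjugate_def by (rule SUP_upper) simp
  obtain r where r: "conjugate \<nu> w \<le> ereal r"
    using fin by (cases "conjugate \<nu> w") auto
  have "u \<bullet> w \<le> \<nu> u" for u
  proof (rule ccontr)
    assume "\<not> u \<bullet> w \<le> \<nu> u"
    then have d: "u \<bullet> w - \<nu> u > 0" by simp
    \<comment> \<open>The supremum grows linearly along the ray through \<open>u\<close>; this
      \<open>t\<close> pushes it to \<open>\<bar>r\<bar> + 1\<close>, beyond the assumed bound
      \<open>r\<close>.\<close>
    define t where "t = (\<bar>r\<bar> + 1) / (u \<bullet> w - \<nu> u)"
    have t: "t > 0" using d by (simp add: t_def)
    have "ereal ((t *\<^sub>R u) \<bullet> w - \<nu> (t *\<^sub>R u)) \<le> ereal r"
      using ge r order_trans by blast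
    then have "t * (u \<bullet> w - \<nu> u) \<le> r"
      using hom[OF t] by (simp add: right_diff_distrib)
    moreover have "t * (u \<bullet> w - \<nu> u) = \<bar>r\<bar> + 1"
      using d by (simp add: t_def)
    ultimately show False by linarith
  qed
  then show "w \<in> {w. \<forall>u. u \<bullet> w \<le> \<nu> u}" by simp
next
  fix w assume w: "w \<in> {w. \<forall>u. u \<bullet> w \<le> \<nu> u}"
  then have "conjugate \<nu> w \<le> ereal 0"
    unfolding conjugate_def by (intro SUP_least) simp
  then have "conjugate \<nu> w < \<infinity>"
    using order_le_less_trans by fastforce
  then show "w \<in> effective_domain (conjugate \<nu>)"
    by (simp add: effective_domain_def)
qed

text \<open>A hyperplane strictly separating the epigraph from \<open>(x, \<nu> x - e)\<close> has a
  normal \<open>(a, b)\<close> with \<open>b > 0\<close>, and its slope \<open>- a / b\<close> is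
  the minorant. A gap of \<open>e\<close> is enough, because the caller lets \<open>e\<close> tend
  to 0.\<close>

lemma sublinear_approx_by_minorant:
  fixes \<nu> :: "'a::euclidean_space \<Rightarrow> real"
  assumes cont: "continuous_on UNIV \<nu>" and conv: "convex_on UNIV \<nu>"
    and hom: "\<And>u \<alpha>. \<alpha> > 0 \<Longrightarrow> \<nu> (\<alpha> *\<^sub>R u) = \<alpha> * \<nu> u"
    and "e > 0"
  obtains w where "\<And>u. u \<bullet> w \<le> \<nu> u" and "\<nu> x - e < x \<bullet> w"
proof -
  have zero: "\<nu> 0 = 0"
    \<comment> \<open>Homogeneity covers positive factors only, so the value at 0 comes from
      \<open>\<nu> 0 = 2 * \<nu> 0\<close>.\<close>
    using hom[of 2 0] by simp
  have "closed (epigraph UNIV \<nu>)"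
  proof -
    have "continuous_on UNIV (\<lambda>z::'a \<times> real. \<nu> (fst z))"
      by (rule continuous_on_compose2[OF cont]) (auto intro: continuous_intros)
    then show ?thesis
      unfolding epigraph_def by (auto intro!: closed_Collect_le continuous_intros)
  qed
  moreover have "convex (epigraph UNIV \<nu>)"
    using conv by (simp add: convex_epigraph)
  moreover have "(x, \<nu> x - e) \<notin> epigraph UNIV \<nu>"
    using \<open>e > 0\<close> by (simp add: epigraph_def)
  ultimately obtain ab c where "ab \<bullet> (x, \<nu> x - e) < c"
    and "\<forall>z\<in>epigraph UNIV \<nu>. ab \<bullet> z > c"
    using separating_hyperplane_closed_point by blast
  moreover obtain a b where "ab = (a, b)" by fastforce
  ultimately have below: "a \<bullet> x + b * (\<nu> x - e) < c"
    and above: "\<And>u t. \<nu> u \<le> t \<Longrightarrow> a \<bullet> u + b * t > c"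
    by (auto simp: epigraph_def)
  \<comment> \<open>The apex \<open>(0, 0)\<close> of the cone lies in the epigraph.\<close>
  have c: "c < 0"
    using above[of 0 0] zero by simp
  have cone: "a \<bullet> u + b * \<nu> u \<ge> 0" for u
  proof (rule ccontr)
    assume "\<not> a \<bullet> u + b * \<nu> u \<ge> 0"
    then have d: "a \<bullet> u + b * \<nu> u < 0" by simp
    \<comment> \<open>A point of the graph with negative value could be rescaled to have value
      exactly \<open>c\<close>, against strict separation.\<close>
    define s where "s = c / (a \<bullet> u + b * \<nu> u)"
    have s: "s > 0" using d c by (simp add: s_def divide_neg_neg)
    have "a \<bullet> (s *\<^sub>R u) + b * \<nu> (s *\<^sub>R u) = s * (a \<bullet> u + b * \<nu> u)"
      using hom[OF s] by (simp add: algebra_simps)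
    also have "\<dots> = c" using d by (simp add: s_def)
    finally show False using above[of "s *\<^sub>R u" "\<nu> (s *\<^sub>R u)"] by simp
  qed
  \<comment> \<open>Lowering the point \<open>(x, \<nu> x)\<close> by \<open>e\<close> takes the
    functional from a nonnegative value to one below \<open>c < 0\<close>, so the hyperplane is not
    vertical.\<close>
  have "b * e > 0"
    using below c cone[of x] by (simp add: algebra_simps)
  then have b: "b > 0"
    using \<open>e > 0\<close> by (simp add: zero_less_mult_iff)
  show thesis
  proof
    show "u \<bullet> (- (1 / b) *\<^sub>R a) \<le> \<nu> u" for u
      using cone[of u] b by (simp add: field_simps inner_commute)
    show "\<nu> x - e < x \<bullet> (- (1 / b) *\<^sub>R a)"
      using below c b by (simp add: field_simps inner_commute)
  qed
qed

text \<open>Sorting the indices by their \<open>f\<close>-values gives the list \<open>ys\<close>;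
  \<open>p\<close> sends the k-th index in the natural order to the k-th entry of \<open>ys\<close>.
  This is what moves an arbitrary minorant into \<open>ordered_vecs\<close>.\<close>

lemma ex_sorting_permutation:
  fixes f :: "'n::{finite,linorder} \<Rightarrow> 'b::linorder"
  obtains p where "p permutes UNIV" and "mono (f \<circ> p)"
proof -
  define xs where "xs = sorted_list_of_set (UNIV :: 'n set)"
  define ys where "ys = sort_key f xs"
  define n where "n = length xs"
  have xs: "sorted xs" "distinct xs" "set xs = UNIV"
    by (auto simp: xs_def)
  have ys: "distinct ys" "set ys = UNIV" "length ys = n" "sorted (map f ys)"
    using xs by (auto simp: ys_def n_def)
  have bij_xs: "bij_betw (nth xs) {..<n} UNIV"
    using xs by (intro bij_betw_nth) (auto simp: n_def)
  have bij_ys: "bij_betw (nth ys) {..<n} UNIV"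
    using ys by (intro bij_betw_nth) auto
  define p where "p = nth ys \<circ> inv_into {..<n} (nth xs)"
  have "bij p"
    unfolding p_def using bij_betw_inv_into[OF bij_xs] bij_ys bij_betw_trans by blast
  then have "p permutes UNIV"
    by (rule bij_imp_permutes) simp
  moreover have "mono (f \<circ> p)"
  proof (rule monoI)
    fix i j :: 'n assume "i \<le> j"
    obtain a b where ab: "a < n" "b < n" "i = xs ! a" "j = xs ! b"
      using xs(3) by (metis UNIV_I in_set_conv_nth n_def)
    have inv: "inv_into {..<n} (nth xs) (xs ! k) = k" if "k < n" for k
      using bij_xs that by (simp add: bij_betw_def)
    have "a \<le> b"
    proof (rule ccontr)
      assume "\<not> a \<le> b"
      then have "xs ! b \<le> xs ! a" using xs(1) ab by (auto simp: n_def intro: sorted_nth_mono)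
      then have "xs ! a = xs ! b" using \<open>i \<le> j\<close> ab by simp
      then show False using \<open>\<not> a \<le> b\<close> xs(2) ab by (simp add: n_def nth_eq_iff_index_eq)
    qed
    then have "map f ys ! a \<le> map f ys ! b"
      using ys ab by (intro sorted_nth_mono) auto
    then show "(f \<circ> p) i \<le> (f \<circ> p) j"
      using ab inv ys by (simp add: p_def)
  qed
  ultimately show thesis by (rule that)
qed

lemma permutation_matrix_vector_mult:
  fixes u :: "real ^ 'n"
  shows "(\<chi> i j. if j = p i then 1 else 0) *v u = (\<chi> i. u $ p i)"
proof (rule vec_eq_iff[THEN iffD2, rule_format])
  fix i
  have "(\<Sum>j\<in>UNIV. (if j = p i then 1 else 0) * u $ j) = (\<Sum>j\<in>UNIV. if j = p i then u $ j else 0)"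
    by (rule sum.cong) auto
  then show "((\<chi> i j. if j = p i then 1 else 0) *v u) $ i = (\<chi> i. u $ p i) $ i"
    by (simp add: matrix_vector_mult_def)
qed

lemma convex_fairness_measure_permute:
  fixes \<nu> :: "real ^ 'n \<Rightarrow> real"
  assumes "convex_fairness_measure \<nu>" and "p permutes UNIV"
  shows "\<nu> (\<chi> i. u $ p i) = \<nu> u"
proof -
  have "permutation_matrix (\<chi> i j. if j = p i then 1 else 0)"
    using assms(2) by (auto simp: permutation_matrix_def)
  then have "\<nu> ((\<chi> i j. if j = p i then 1 else 0) *v u) = \<nu> u"
    using assms(1) unfolding convex_fairness_measure_def by blast
  then show ?thesis by (simp only: permutation_matrix_vector_mult)
qed

lemma inner_permute:
  fixes u w :: "real ^ 'n"
  assumes "p permutes UNIV"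
  shows "(\<chi> i. u $ p i) \<bullet> (\<chi> i. w $ p i) = u \<bullet> w"
  using sum.permute[OF assms, of "\<lambda>i. u $ i * w $ i"]
  by (simp add: inner_vec_def o_def)

text \<open>Permuting both vectors preserves the inner product, and permuting \<open>u\<close>
  preserves \<open>\<nu> u\<close>; as \<open>u\<close> ranges over all vectors, so does its
  permuted copy.\<close>

lemma minorant_permute_iff:
  fixes \<nu> :: "real ^ 'n \<Rightarrow> real"
  assumes \<nu>: "convex_fairness_measure \<nu>" and p: "p permutes UNIV"
  shows "(\<forall>u. u \<bullet> (\<chi> i. w $ p i) \<le> \<nu> u) \<longleftrightarrow> (\<forall>u. u \<bullet> w \<le> \<nu> u)"
proof
  assume *: "\<forall>u. u \<bullet> (\<chi> i. w $ p i) \<le> \<nu> u"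
  show "\<forall>u. u \<bullet> w \<le> \<nu> u"
  proof
    fix u :: "real ^ 'n"
    show "u \<bullet> w \<le> \<nu> u"
      using *[rule_format, of "\<chi> i. u $ p i"]
      by (simp add: inner_permute[OF p] convex_fairness_measure_permute[OF \<nu> p])
  qed
next
  assume *: "\<forall>u. u \<bullet> w \<le> \<nu> u"
  show "\<forall>u. u \<bullet> (\<chi> i. w $ p i) \<le> \<nu> u"
  proof
    fix u :: "real ^ 'n"
    \<comment> \<open>The preimage of \<open>u\<close> under the coordinate permutation.\<close>
    define v :: "real ^ 'n" where "v = (\<chi> i. u $ inv p i)"
    have u: "u = (\<chi> i. v $ p i)"
      using permutes_inverses(2)[OF p] by (simp add: v_def vec_eq_iff)
    show "u \<bullet> (\<chi> i. w $ p i) \<le> \<nu> u"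
      using * unfolding u
      by (simp only: inner_permute[OF p] convex_fairness_measure_permute[OF \<nu> p])
  qed
qed

lemma convex_fairness_measureD:
  assumes "convex_fairness_measure \<nu>"
  shows "continuous_on UNIV \<nu>" and "convex_on UNIV \<nu>"
    and "\<And>u \<alpha>. \<alpha> > 0 \<Longrightarrow> \<nu> (\<alpha> *\<^sub>R u) = \<alpha> * \<nu> u"
  using assms unfolding convex_fairness_measure_def by blast+

lemma mem_dual_set_iff:
  fixes \<nu> :: "real ^ 'n::{finite,linorder} \<Rightarrow> real"
  assumes "convex_fairness_measure \<nu>"
  shows "w \<in> dual_set \<nu> \<longleftrightarrow> (\<forall>u. u \<bullet> w \<le> \<nu> u) \<and> w \<in> ordered_vecs"
  using effective_domain_conjugate_homogeneous[OF convex_fairness_measureD(3)[OF assms]]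
  by (simp add: dual_set_def)

text \<open>One half of the comparison, stated with an inclusion so that it can be applied again
  with the measures swapped and factor \<open>1 / \<beta>\<close>. A minorant of
  \<open>\<nu>1\<close> almost touching at \<open>x\<close> is sorted, scaled into a minorant of
  \<open>\<nu>2\<close>, and unsorted.\<close>

lemma le_scaled_of_dual_set_subset:
  fixes \<nu>1 \<nu>2 :: "real ^ 'n::{finite,linorder} \<Rightarrow> real"
  assumes \<nu>1: "convex_fairness_measure \<nu>1" and \<nu>2: "convex_fairness_measure \<nu>2"
    and "\<beta> > 0"
    and sub: "dual_set \<nu>1 \<subseteq> {\<beta> *\<^sub>R w | w. w \<in> dual_set \<nu>2}"
  shows "\<nu>1 x \<le> \<beta> * \<nu>2 x"
proof (rule field_le_epsilon)
  fix e :: real assume "e > 0"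
  obtain w where w: "\<And>u. u \<bullet> w \<le> \<nu>1 u" "\<nu>1 x - e < x \<bullet> w"
    using sublinear_approx_by_minorant[OF convex_fairness_measureD[OF \<nu>1] \<open>e > 0\<close>, of x] by blast
  \<comment> \<open>The minorant \<open>w\<close> need not be ordered, while the inclusion speaks
    only of ordered vectors.\<close>
  obtain p where p: "p permutes UNIV" "mono (($) w \<circ> p)"
    by (rule ex_sorting_permutation)
  define z where "z = (\<chi> i. w $ p i)"
  have "z \<in> ordered_vecs"
    using p(2) by (simp add: z_def ordered_vecs_def mono_def)
  moreover have "\<forall>u. u \<bullet> z \<le> \<nu>1 u"
    unfolding z_def using minorant_permute_iff[OF \<nu>1 p(1)] w(1) by blast
  ultimately obtain y where y: "z = \<beta> *\<^sub>R y" "y \<in> dual_set \<nu>2"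
    using sub mem_dual_set_iff[OF \<nu>1] by blast
  \<comment> \<open>Since \<open>y\<close> is the sorted copy of \<open>w / \<beta>\<close>,
    symmetry of \<open>\<nu>2\<close> makes \<open>w / \<beta>\<close> itself a minorant of
    \<open>\<nu>2\<close>, which can be tested at the original \<open>x\<close>.\<close>
  have "y = (\<chi> i. ((1 / \<beta>) *\<^sub>R w) $ p i)"
  proof (rule vec_eq_iff[THEN iffD2, rule_format])
    fix i
    have "w $ p i = \<beta> * y $ i"
      using arg_cong[OF y(1), of "\<lambda>v. v $ i"] by (simp add: z_def)
    then show "y $ i = (\<chi> i. ((1 / \<beta>) *\<^sub>R w) $ p i) $ i"
      using \<open>\<beta> > 0\<close> by simp
  qed
  then have "x \<bullet> ((1 / \<beta>) *\<^sub>R w) \<le> \<nu>2 x"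
    using y(2) mem_dual_set_iff[OF \<nu>2] minorant_permute_iff[OF \<nu>2 p(1)] by blast
  then have "x \<bullet> w \<le> \<beta> * \<nu>2 x"
    using \<open>\<beta> > 0\<close> by (simp add: field_simps)
  then show "\<nu>1 x \<le> \<beta> * \<nu>2 x + e"
    using w(2) by linarith
qed

lemma eq_scaled_set_iff:
  fixes A B :: "'a::real_vector set"
  assumes "\<beta> > (0::real)"
  shows "A = {\<beta> *\<^sub>R w | w. w \<in> B} \<longleftrightarrow> (\<forall>w. \<beta> *\<^sub>R w \<in> A \<longleftrightarrow> w \<in> B)"
proof
  assume "A = {\<beta> *\<^sub>R w | w. w \<in> B}"
  then show "\<forall>w. \<beta> *\<^sub>R w \<in> A \<longleftrightarrow> w \<in> B" using assms by auto
next
  assume *: "\<forall>w. \<beta> *\<^sub>R w \<in> A \<longleftrightarrow> w \<in> B"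
  show "A = {\<beta> *\<^sub>R w | w. w \<in> B}"
  proof (intro set_eqI iffI)
    fix a assume "a \<in> A"
    moreover have "a = \<beta> *\<^sub>R ((1 / \<beta>) *\<^sub>R a)" using assms by simp
    ultimately show "a \<in> {\<beta> *\<^sub>R w | w. w \<in> B}" using * by fastforce
  qed (use * in auto)
qed

theorem theorem4:
  fixes \<nu>1 \<nu>2 :: "real ^ 'n::{finite,linorder} \<Rightarrow> real"
  assumes "convex_fairness_measure \<nu>1" and "convex_fairness_measure \<nu>2"
  shows "equivalent_measures \<nu>1 \<nu>2 \<longleftrightarrow>
    (\<exists>\<beta>>0. dual_set \<nu>1 = {\<beta> *\<^sub>R w | w. w \<in> dual_set \<nu>2})"
proof
  assume "equivalent_measures \<nu>1 \<nu>2"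
  then obtain \<beta> where \<beta>: "\<beta> > 0" "\<And>u. \<nu>1 u = \<beta> * \<nu>2 u"
    by (auto simp: equivalent_measures_def)
  \<comment> \<open>Dividing by \<open>\<beta>\<close> turns the minorant condition for
    \<open>\<nu>1 = \<beta> * \<nu>2\<close> at \<open>\<beta> *\<^sub>R w\<close> into that for
    \<open>\<nu>2\<close> at \<open>w\<close>, and positive scaling preserves the ordering of
    coordinates.\<close>
  have "\<forall>w. \<beta> *\<^sub>R w \<in> dual_set \<nu>1 \<longleftrightarrow> w \<in> dual_set \<nu>2"
    using \<beta> by (simp add: mem_dual_set_iff[OF assms(1)] mem_dual_set_iff[OF assms(2)] ordered_vecs_def)
  then show "\<exists>\<beta>>0. dual_set \<nu>1 = {\<beta> *\<^sub>R w | w. w \<in> dual_set \<nu>2}"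
    using \<beta>(1) eq_scaled_set_iff by blast
next
  assume "\<exists>\<beta>>0. dual_set \<nu>1 = {\<beta> *\<^sub>R w | w. w \<in> dual_set \<nu>2}"
  then obtain \<beta> where \<beta>: "\<beta> > 0" and eq: "dual_set \<nu>1 = {\<beta> *\<^sub>R w | w. w \<in> dual_set \<nu>2}"
    by blast
  \<comment> \<open>Inverting the scaling gives the inclusion needed for the reverse
    inequality.\<close>
  have "dual_set \<nu>2 \<subseteq> {(1 / \<beta>) *\<^sub>R w | w. w \<in> dual_set \<nu>1}"
  proof
    fix w assume "w \<in> dual_set \<nu>2"
    then have "\<beta> *\<^sub>R w \<in> dual_set \<nu>1" using eq by blast
    moreover have "w = (1 / \<beta>) *\<^sub>R (\<beta> *\<^sub>R w)" using \<beta> by simp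
    ultimately show "w \<in> {(1 / \<beta>) *\<^sub>R w | w. w \<in> dual_set \<nu>1}" by blast
  qed
  then have ge: "\<nu>2 u \<le> (1 / \<beta>) * \<nu>1 u" for u
    using \<beta> by (intro le_scaled_of_dual_set_subset[OF assms(2,1)]) auto
  have le: "\<nu>1 u \<le> \<beta> * \<nu>2 u" for u
    using eq \<beta> by (intro le_scaled_of_dual_set_subset[OF assms]) auto
  have "\<nu>1 u = \<beta> * \<nu>2 u" for u
  proof (rule antisym)
    show "\<nu>1 u \<le> \<beta> * \<nu>2 u" by (rule le)
    have "\<beta> * \<nu>2 u \<le> \<beta> * ((1 / \<beta>) * \<nu>1 u)"
      using ge \<beta> by (intro mult_left_mono) auto
    then show "\<beta> * \<nu>2 u \<le> \<nu>1 u" using \<beta> by simp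
  qed
  then show "equivalent_measures \<nu>1 \<nu>2"
    using \<beta> by (auto simp: equivalent_measures_def)
qed

end
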